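(* Let $n\ge1$ and let $\mathbb K$ be the Klein bottle. The BNS invariant $\Sigma^1(P_n(\mathbb K))$ and its complement $\Sigma^1(P_n(\mathbb K))^c$ are invariant under all permutations of coordinates in $S(P_n(\mathbb K))$, i.e. under the map $(x_1,\dots,x_n)\mapsto(x_{\tau(1)},\dots,x_{\tau(n)})$ for every $\tau\in S_n$.
   Context: **Pure braid groups and coordinates.** $F_n(\mathbb K)=\{(x_1,\dots,x_n)\in \mathbb K^n : x_i\ne x_j\text{ for }i\ne j\}$ and $P_n(\mathbb K)=\pi_1(F_n(\mathbb K))$. Write $\pi_1(\mathbb K)=\langle a,b\mid b^{-1}ab=a^{-1}\rangle$. For $1\le i\le n$, $b_i\in P_n(\mathbb K)$ is the pure braid in which only the $i$-th string is non-trivial, this string running once along a loop representing $b$ and avoiding the other base points. The classes of $b_1,\dots,b_n$ form a basis of the free part of the abelianization $\mathbb Z_2^n\oplus\mathbb Z^n$ of $P_n(\mathbb K)$, and $S(P_n(\mathbb K))$ is identified with $\mathbb S^{n-1}$ by sending $[\chi]$ to the normalization of $(x_1,\dots,x_n)=(\chi(b_1),\dots,\chi(b_n))$. **BNS invariant.** For a finitely generated group $G$, the character sphere is $S(G)=(\mathrm{Hom}(G,\mathbb R)\setminus\{0\})/\sim$, where $\chi\sim\chi'$ iff $\chi'=r\chi$ for some real $r>0$; the class of $\chi$ is $[\chi]$. Fix a finite generating set $X$ of $G$ and let $\Gamma$ be the Cayley graph with vertex set $G$ and edges joining $g$ to $gz$, $z\in X^{\pm1}$. For a nonzero $\chi$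 let $\Gamma_\chi$ be the full subgraph of $\Gamma$ on the vertices $g$ with $\chi(g)\ge 0$. Then $\Sigma^1(G)=\{[\chi]\in S(G) : \Gamma_\chi \text{ is connected}\}$ (independent of $X$), and $\Sigma^1(G)^c=S(G)\setminus\Sigma^1(G)$. *)

theory Defs
  imports "HOL-Analysis.Analysis" "HOL-Algebra.Generated_Groups"
begin

section \<open>The Klein bottle\<close>

text \<open>The Klein bottle is the orbit space of the plane under the group generated by
  \<open>a: (x, y) \<mapsto> (x, y + 1)\<close> and \<open>b: (x, y) \<mapsto> (x + 1, - y)\<close>, which satisfy
  \<open>b\<inverse> a b = a\<inverse>\<close>; every element of this group has the form
  \<open>a\<^sup>k b\<^sup>m: (x, y) \<mapsto> (x + m, (- 1)\<^sup>m y + k)\<close>.\<close>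

definition klein_rel :: "real \<times> real \<Rightarrow> real \<times> real \<Rightarrow> bool" where
  "klein_rel p q \<longleftrightarrow> (\<exists>m k :: int.
     q = (fst p + of_int m, (if even m then snd p else - snd p) + of_int k))"

lemma equivp_klein_rel: "equivp klein_rel"
proof (rule equivpI)
  show "reflp klein_rel"
    unfolding reflp_def klein_rel_def by (intro allI exI[of _ 0]) simp
  show "symp klein_rel"
  proof (rule sympI)
    fix p q assume "klein_rel p q"
    then obtain m k :: int
      where q: "q = (fst p + of_int m, (if even m then snd p else - snd p) + of_int k)"
      unfolding klein_rel_def by blast
    show "klein_rel q p"
      unfolding klein_rel_def
      by (rule exI[of _ "- m"], rule exI[of _ "if even m then - k else k"]) (simp add: q prod_eq_iff)
  qed
  show "transp klein_rel"
  proof (rule transpI)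
    fix p q r assume "klein_rel p q" "klein_rel q r"
    then obtain m k m' k' :: int
      where q: "q = (fst p + of_int m, (if even m then snd p else - snd p) + of_int k)"
        and r: "r = (fst q + of_int m', (if even m' then snd q else - snd q) + of_int k')"
      unfolding klein_rel_def by blast
    show "klein_rel p r"
      unfolding klein_rel_def
      by (rule exI[of _ "m + m'"], rule exI[of _ "(if even m' then k else - k) + k'"])
        (simp add: q r prod_eq_iff)
  qed
qed

quotient_type klein = "real \<times> real" / klein_rel
  by (rule equivp_klein_rel)

text \<open>The topology is the quotient topology.\<close>

instantiation klein :: topological_space
begin

definition open_klein :: "klein set \<Rightarrow> bool" where
  "open_klein U \<longleftrightarrow> open (abs_klein -` U)"

instance
proof
  show "open (UNIV :: klein set)"
    by (simp add: open_klein_def)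
  show "open (S \<inter> T)" if "open S" "open T" for S T :: "klein set"
    using that by (simp add: open_klein_def open_Int)
  show "open (\<Union>\<K>)" if "\<forall>S\<in>\<K>. open S" for \<K> :: "klein set set"
    using that by (simp add: open_klein_def vimage_Union open_UN)
qed

end


section \<open>Fundamental groups and pure braid groups\<close>

definition homotopy_class :: "'a::topological_space set \<Rightarrow> (real \<Rightarrow> 'a) \<Rightarrow> (real \<Rightarrow> 'a) set" where
  "homotopy_class S p = {q. homotopic_paths S p q}"

definition fundamental_group ::
    "'a::topological_space set \<Rightarrow> 'a \<Rightarrow> (real \<Rightarrow> 'a) set monoid" where
  "fundamental_group S x =
    \<lparr>carrier = homotopy_class S `
       {p. path p \<and> path_image p \<subseteq> S \<and> pathstart p = x \<and> pathfinish p = x},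
     mult = (\<lambda>A B. \<Union>p\<in>A. \<Union>q\<in>B. homotopy_class S (p +++ q)),
     one = homotopy_class S (\<lambda>t. x)\<rparr>"

text \<open>Points of the \<open>n\<close>-fold power of a space are functions on \<open>nat\<close> that are \<open>undefined\<close>
  outside \<open>{1..n}\<close>. The topology on \<open>nat \<Rightarrow> 'a\<close> is the product topology.\<close>

definition configuration_space :: "nat \<Rightarrow> (nat \<Rightarrow> 'a::topological_space) set" where
  "configuration_space n =
     {x \<in> {1..n} \<rightarrow>\<^sub>E UNIV. \<forall>i\<in>{1..n}. \<forall>j\<in>{1..n}. i \<noteq> j \<longrightarrow> x i \<noteq> x j}"

text \<open>The base points are placed on the circle \<open>{0} \<times> \<real>\<close> at heights between \<open>0\<close> and \<open>1\<close>.\<close>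

definition base_height :: "nat \<Rightarrow> nat \<Rightarrow> real" where
  "base_height n i = real i / real (n + 1)"

definition base_config :: "nat \<Rightarrow> nat \<Rightarrow> klein" where
  "base_config n = (\<lambda>i\<in>{1..n}. abs_klein (0, base_height n i))"

definition pure_braid_group :: "nat \<Rightarrow> (real \<Rightarrow> nat \<Rightarrow> klein) set monoid" where
  "pure_braid_group n = fundamental_group (configuration_space n) (base_config n)"

text \<open>A loop representing \<open>b\<close> at the \<open>i\<close>-th base point is the image of the segment from
  \<open>(0, y)\<close> to \<open>b (0, y) = (1, - y)\<close>. In its interior the first coordinate is not an integer, so
  it avoids the other base points. Conjugating it with the vertical segment from \<open>(0, 0)\<close> to
  \<open>(0, y)\<close> gives exactly the element \<open>b\<close> of the fundamental group based at the image of
  \<open>(0, 0)\<close>.\<close>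

definition b_loop :: "nat \<Rightarrow> nat \<Rightarrow> real \<Rightarrow> klein" where
  "b_loop n i t = abs_klein (linepath (0, base_height n i) (1, - base_height n i) t)"

definition b_braid :: "nat \<Rightarrow> nat \<Rightarrow> (real \<Rightarrow> nat \<Rightarrow> klein) set" where
  "b_braid n i = homotopy_class (configuration_space n)
     (\<lambda>t. (base_config n)(i := b_loop n i t))"


section \<open>The character sphere and the BNS invariant\<close>

definition real_add_group :: "real monoid" where
  "real_add_group = \<lparr>carrier = UNIV, mult = (+), one = 0\<rparr>"

text \<open>Characters are normalized to be \<open>undefined\<close> outside the carrier, so that equality of
  characters is equality of functions.\<close>

definition nonzero_characters :: "('a, 'm) monoid_scheme \<Rightarrow> ('a \<Rightarrow> real) set" where
  "nonzero_characters G =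
     {\<xi> \<in> hom G real_add_group \<inter> extensional (carrier G). \<exists>g\<in>carrier G. \<xi> g \<noteq> 0}"

definition character_class :: "('a, 'm) monoid_scheme \<Rightarrow> ('a \<Rightarrow> real) \<Rightarrow> ('a \<Rightarrow> real) set" where
  "character_class G \<xi> =
     {\<xi>' \<in> nonzero_characters G. \<exists>r>0. \<forall>g\<in>carrier G. \<xi>' g = r * \<xi> g}"

definition character_sphere :: "('a, 'm) monoid_scheme \<Rightarrow> ('a \<Rightarrow> real) set set" where
  "character_sphere G = character_class G ` nonzero_characters G"

definition cayley_edges :: "('a, 'm) monoid_scheme \<Rightarrow> 'a set \<Rightarrow> ('a \<times> 'a) set" where
  "cayley_edges G X =
     {(g, g \<otimes>\<^bsub>G\<^esub> z) | g z. g \<in> carrier G \<and> z \<in> X \<union> m_inv G ` X}"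

text \<open>Connectedness of the full subgraph of a graph with symmetric edge relation \<open>E\<close> on the
  vertex set \<open>V\<close>.\<close>

definition full_subgraph_connected :: "('a \<times> 'a) set \<Rightarrow> 'a set \<Rightarrow> bool" where
  "full_subgraph_connected E V \<longleftrightarrow> (\<forall>u\<in>V. \<forall>v\<in>V. (u, v) \<in> (E \<inter> V \<times> V)\<^sup>*)"

definition Sigma1 :: "('a, 'm) monoid_scheme \<Rightarrow> 'a set \<Rightarrow> ('a \<Rightarrow> real) set set" where
  "Sigma1 G X = {character_class G \<xi> | \<xi>. \<xi> \<in> nonzero_characters G \<and>
     full_subgraph_connected (cayley_edges G X) {g \<in> carrier G. \<xi> g \<ge> 0}}"

definition Sigma1_compl :: "('a, 'm) monoid_scheme \<Rightarrow> 'a set \<Rightarrow> ('a \<Rightarrow> real) set set" where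
  "Sigma1_compl G X = character_sphere G - Sigma1 G X"


section \<open>Coordinates on the character sphere of the pure braid group\<close>

definition normalization :: "nat \<Rightarrow> (nat \<Rightarrow> real) \<Rightarrow> nat \<Rightarrow> real" where
  "normalization n x = (\<lambda>i\<in>{1..n}. x i / sqrt (\<Sum>j=1..n. (x j)\<^sup>2))"

text \<open>All members of a class of characters have the same normalized coordinates.\<close>

definition sphere_coordinates ::
    "nat \<Rightarrow> ((real \<Rightarrow> nat \<Rightarrow> klein) set \<Rightarrow> real) set \<Rightarrow> nat \<Rightarrow> real" where
  "sphere_coordinates n c = the_elem ((\<lambda>\<xi>. normalization n (\<lambda>i. \<xi> (b_braid n i))) ` c)"

definition permute_coordinates :: "nat \<Rightarrow> (nat \<Rightarrow> nat) \<Rightarrow> (nat \<Rightarrow> real) \<Rightarrow> nat \<Rightarrow> real" where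
  "permute_coordinates n \<tau> x = (\<lambda>i\<in>{1..n}. x (\<tau> i))"

end

theory Submission
  imports Defs
begin

text \<open>It suffices to find, for every permutation \<open>\<tau>\<close>, an automorphism of \<open>P\<^sub>n\<close> under which
  the coordinates of characters are permuted by \<open>\<tau>\<close>, because \<open>\<Sigma>\<^sup>1\<close> does not depend on the
  finite generating set and hence is invariant under automorphisms. Relabelling the points by
  \<open>\<tau>\<close> is a homeomorphism of the configuration space that moves the base point; composing it
  with the change of base point along a path \<open>\<gamma>\<close> gives an automorphism. Another choice of
  \<open>\<gamma>\<close> changes it by an inner automorphism, which characters do not see, so \<open>\<gamma>\<close> may be
  chosen separately for each \<open>k\<close>. For a suitable \<open>\<gamma>\<close> the loop \<open>b\<^sub>k\<close> can be carried along
  \<open>\<gamma>\<close> to the loop \<open>b\<^bsub>\<tau> k\<^esub>\<close> without meeting the other points.\<close>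

section \<open>Invariance of \<open>\<Sigma>\<^sup>1\<close> under automorphisms\<close>

locale real_character = group G for G (structure) +
  fixes \<eta> :: "'a \<Rightarrow> real"
  assumes character: "\<eta> \<in> hom G real_add_group"
begin

lemma character_mult [simp]:
  "x \<in> carrier G \<Longrightarrow> y \<in> carrier G \<Longrightarrow> \<eta> (x \<otimes> y) = \<eta> x + \<eta> y"
  using character by (simp add: real_add_group_def hom_def)

lemma character_one [simp]: "\<eta> \<one> = 0"
  using character_mult[of \<one> \<one>] by simp

lemma character_inv [simp]: "x \<in> carrier G \<Longrightarrow> \<eta> (inv x) = - \<eta> x"
  using character_mult[of x "inv x"] by simp

lemma character_pow [simp]: "x \<in> carrier G \<Longrightarrow> \<eta> (x [^] (m::nat)) = real m * \<eta> x"
  by (induction m) (auto simp: algebra_simps)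

section \<open>Paths in half spaces of the Cayley graph\<close>

definition half_space :: "real \<Rightarrow> 'a set" where
  "half_space c = {g \<in> carrier G. \<eta> g \<ge> c}"

text \<open>The level \<open>c\<close> is variable because left translation by \<open>g\<close>
  shifts it by \<open>\<eta> g\<close>, and because a path that spells a word may dip below
  0.\<close>

definition reach :: "'a set \<Rightarrow> real \<Rightarrow> ('a \<times> 'a) set" where
  "reach X c = (cayley_edges G X \<inter> half_space c \<times> half_space c)\<^sup>*"

lemma reach_mono: "c' \<le> c \<Longrightarrow> reach X c \<subseteq> reach X c'"
  unfolding reach_def half_space_def by (rule rtrancl_mono) auto

lemma reach_trans: "(u, v) \<in> reach X c \<Longrightarrow> (v, w) \<in> reach X c \<Longrightarrow> (u, w) \<in> reach X c"
  unfolding reach_def by (rule rtrancl_trans)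

lemma cayley_edgeE:
  assumes "(u, v) \<in> cayley_edges G X"
  obtains z where "u \<in> carrier G" "z \<in> X \<union> m_inv G ` X" "v = u \<otimes> z"
  using assms unfolding cayley_edges_def by blast

lemma generators_carrier: "X \<subseteq> carrier G \<Longrightarrow> z \<in> X \<union> m_inv G ` X \<Longrightarrow> z \<in> carrier G"
  by (elim UnE imageE) auto

lemma reach_edge:
  assumes "X \<subseteq> carrier G" "z \<in> X \<union> m_inv G ` X" "u \<in> carrier G" "c \<le> \<eta> u" "c \<le> \<eta> (u \<otimes> z)"
  shows "(u, u \<otimes> z) \<in> reach X c"
proof -
  have "z \<in> carrier G" using assms(1,2) by (rule generators_carrier)
  then have "u \<in> half_space c" "u \<otimes> z \<in> half_space c"
    unfolding half_space_def using assms(3-5) by auto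
  moreover have "(u, u \<otimes> z) \<in> cayley_edges G X"
    unfolding cayley_edges_def using assms(2,3) by blast
  ultimately show ?thesis unfolding reach_def by blast
qed

lemma reach_sym:
  assumes "X \<subseteq> carrier G" and "(u, v) \<in> reach X c"
  shows "(v, u) \<in> reach X c"
proof -
  have "sym (cayley_edges G X)"
  proof (rule symI)
    fix g h assume "(g, h) \<in> cayley_edges G X"
    then obtain z where z: "g \<in> carrier G" "z \<in> X \<union> m_inv G ` X" "h = g \<otimes> z"
      by (rule cayley_edgeE)
    have zc: "z \<in> carrier G" using assms(1) z(2) by (rule generators_carrier)
    have "inv z \<in> X \<union> m_inv G ` X"
      using z(2)
    proof
      assume "z \<in> m_inv G ` X"
      then obtain x where "x \<in> X" "z = inv x" by blast
      then show ?thesis using assms(1) by (simp add: subset_iff)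
    qed simp
    moreover have "g = h \<otimes> inv z" using z(1,3) zc by (simp add: m_assoc)
    moreover have "h \<in> carrier G" using z(1,3) zc by simp
    ultimately show "(h, g) \<in> cayley_edges G X"
      unfolding cayley_edges_def by blast
  qed
  then have "sym (reach X c)"
    unfolding reach_def by (intro sym_rtrancl sym_Int) (auto simp: sym_def)
  with assms(2) show ?thesis by (rule symD[rotated])
qed

text \<open>Edges multiply on the right, so left multiplication by \<open>g\<close> is a symmetry of
  the Cayley graph; it adds \<open>\<eta> g\<close> to the value at every vertex.\<close>

lemma reach_translate:
  assumes X: "X \<subseteq> carrier G" and g: "g \<in> carrier G" and uv: "(u, v) \<in> reach X c"
  shows "(g \<otimes> u, g \<otimes> v) \<in> reach X (c + \<eta> g)"
  using uv unfolding reach_def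
proof (induction rule: rtrancl_induct)
  case (step v w)
  then obtain z where z: "v \<in> carrier G" "z \<in> X \<union> m_inv G ` X" "w = v \<otimes> z"
    by (meson IntD1 cayley_edgeE)
  have zc: "z \<in> carrier G" using X z(2) by (rule generators_carrier)
  have "c \<le> \<eta> v" "c \<le> \<eta> w" using step.hyps by (auto simp: half_space_def)
  then have "(g \<otimes> v, (g \<otimes> v) \<otimes> z) \<in> reach X (c + \<eta> g)"
    using z(1,3) zc g by (intro reach_edge X z(2)) auto
  then have "(g \<otimes> v, g \<otimes> w) \<in> reach X (c + \<eta> g)"
    using z(1,3) zc g by (simp add: m_assoc)
  with step.IH show ?case
    unfolding reach_def by (rule rtrancl_trans)
qed simp

text \<open>A word in the generators spells a finite path from \<open>\<one>\<close>, and
  \<open>c\<close> is a lower bound for the values on it. For a product, the path of the second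
  factor is translated by the first factor.\<close>

lemma reach_generate:
  assumes X: "X \<subseteq> carrier G" and g: "g \<in> generate G X"
  shows "\<exists>c. (\<one>, g) \<in> reach X c"
  using g
proof induction
  case one
  show ?case by (auto simp: reach_def)
next
  case (incl h)
  with X have "(\<one>, \<one> \<otimes> h) \<in> reach X (min 0 (\<eta> h))"
    by (intro reach_edge) auto
  moreover have "\<one> \<otimes> h = h" using incl X by auto
  ultimately show ?case by auto
next
  case (inv h)
  with X have "(\<one>, \<one> \<otimes> inv h) \<in> reach X (min 0 (\<eta> (inv h)))"
    by (intro reach_edge) auto
  moreover have "\<one> \<otimes> inv h = inv h" using inv X by auto
  ultimately show ?case by auto
next
  case (eng g h)
  then obtain c d where cd: "(\<one>, g) \<in> reach X c" "(\<one>, h) \<in> reach X d" by auto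
  have gc: "g \<in> carrier G" using eng X generate_in_carrier by blast
  have "(g, g \<otimes> h) \<in> reach X (d + \<eta> g)"
    using reach_translate[OF X gc cd(2)] gc by simp
  then have "(\<one>, g \<otimes> h) \<in> reach X (min c (d + \<eta> g))"
    using cd(1) reach_mono by (meson min.cobounded1 min.cobounded2 reach_trans subsetD)
  then show ?case by blast
qed

text \<open>A character that vanishes on a generating set is zero. A generator with negative value
  is replaced by its inverse.\<close>

lemma exists_positive_generator:
  assumes X: "X \<subseteq> carrier G" "generate G X = carrier G" and nz: "\<exists>g\<in>carrier G. \<eta> g \<noteq> 0"
  obtains t where "t \<in> X \<union> m_inv G ` X" "\<eta> t > 0"
proof -
  have "\<exists>x\<in>X. \<eta> x \<noteq> 0"
  proof (rule ccontr)
    assume 0: "\<not> ?thesis"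
    have "\<eta> g = 0" if "g \<in> generate G X" for g
      using that
    proof induction
      case (eng g h)
      then show ?case using X generate_in_carrier by (metis add_0 character_mult)
    qed (use 0 X in auto)
    with X nz show False by auto
  qed
  then obtain x where x: "x \<in> X" "\<eta> x \<noteq> 0" by auto
  show ?thesis
  proof (cases "\<eta> x > 0")
    case False
    with x X have "\<eta> (inv x) > 0" by (simp add: subset_iff)
    with x(1) show ?thesis by (intro that[of "inv x"]) blast+
  qed (use x that in blast)
qed

text \<open>Each further factor \<open>t\<close> raises the value, so the path never falls below its
  starting level.\<close>

lemma reach_pow:
  assumes X: "X \<subseteq> carrier G" and t: "t \<in> X \<union> m_inv G ` X" "\<eta> t > 0" and u: "u \<in> carrier G"
  shows "(u, u \<otimes> t [^] (m::nat)) \<in> reach X (\<eta> u)"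
proof (induction m)
  case (Suc m)
  have tc: "t \<in> carrier G" using X t(1) by (rule generators_carrier)
  have "(u \<otimes> t [^] m, (u \<otimes> t [^] m) \<otimes> t) \<in> reach X (\<eta> u)"
    using t(2) u tc by (intro reach_edge X t(1)) auto
  with Suc show ?case using u tc by (auto simp: m_assoc intro: reach_trans)
qed (use u in \<open>simp add: reach_def\<close>)

text \<open>A path through generators from \<open>Y\<close> becomes a path through generators from \<open>X\<close> that may
  descend by a bounded amount below the half space. Multiplying \<open>u\<close> and \<open>v\<close> on the right by a
  large power \<open>s\<close> of a generator with positive value lifts the path enough to compensate: a
  path from \<open>s\<inverse> u s\<close> to \<open>s\<inverse> v s\<close> in the half space is translated by \<open>s\<close>.\<close>

lemma connected_change_generators:
  assumes X: "X \<subseteq> carrier G" "generate G X = carrier G"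
    and Y: "finite Y" "Y \<subseteq> carrier G"
    and nz: "\<exists>g\<in>carrier G. \<eta> g \<noteq> 0"
    and conn: "full_subgraph_connected (cayley_edges G Y) {g \<in> carrier G. \<eta> g \<ge> 0}"
  shows "full_subgraph_connected (cayley_edges G X) {g \<in> carrier G. \<eta> g \<ge> 0}"
proof -
  obtain t where t: "t \<in> X \<union> m_inv G ` X" "\<eta> t > 0"
    using exists_positive_generator[OF X nz] .
  have tc: "t \<in> carrier G" using X(1) t(1) by (rule generators_carrier)
  have "\<forall>y\<in>Y \<union> m_inv G ` Y. \<exists>c. (\<one>, y) \<in> reach X c"
    using reach_generate[OF X(1)] generators_carrier[OF Y(2)] unfolding X(2) by blast
  then obtain c where c: "\<And>y. y \<in> Y \<union> m_inv G ` Y \<Longrightarrow> (\<one>, y) \<in> reach X (c y)"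
    by metis
  \<comment> \<open>Since \<open>Y\<close> is finite, one level serves for the paths that replace
    all edges labelled by \<open>Y\<close> and its inverses. The entry 0 keeps the set nonempty when
    \<open>Y\<close> is empty.\<close>
  define d where "d = Min (c ` (Y \<union> m_inv G ` Y) \<union> {0})"
  have d: "(\<one>, y) \<in> reach X d" if "y \<in> Y \<union> m_inv G ` Y" for y
  proof -
    have "d \<le> c y" unfolding d_def using that Y by (intro Min_le) auto
    with c[OF that] reach_mono show ?thesis by blast
  qed
  have Y_to_X: "(u, v) \<in> reach X 0" if "(u, v) \<in> reach Y (- d)" for u v
    using that unfolding reach_def[of Y]
  proof (induction rule: rtrancl_induct)
    case (step v w)
    then obtain z where z: "v \<in> carrier G" "z \<in> Y \<union> m_inv G ` Y" "w = v \<otimes> z" "\<eta> v \<ge> - d"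
      unfolding half_space_def by (blast elim: cayley_edgeE)
    then have "(v, w) \<in> reach X (d + \<eta> v)"
      using reach_translate[OF X(1) z(1) d[OF z(2)]] by simp
    moreover have "0 \<le> d + \<eta> v" using z(4) by simp
    ultimately have "(v, w) \<in> reach X 0" using reach_mono by blast
    with step.IH show ?case by (rule reach_trans)
  qed (simp add: reach_def)
  obtain m :: nat where m: "real m * \<eta> t \<ge> - d"
    using reals_Archimedean3[OF t(2)] less_imp_le by blast
  define s where "s = t [^] m"
  have s: "s \<in> carrier G" "\<eta> s \<ge> - d" using tc m by (auto simp: s_def)
  have "(u, v) \<in> reach X 0" if "u \<in> half_space 0" "v \<in> half_space 0" for u v
  proof -
    have uv: "u \<in> carrier G" "v \<in> carrier G" "\<eta> u \<ge> 0" "\<eta> v \<ge> 0"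
      using that by (auto simp: half_space_def)
    \<comment> \<open>Conjugation by \<open>s\<close> leaves the values of \<open>\<eta>\<close>
      unchanged, so both ends lie in the half space.\<close>
    have "(inv s \<otimes> (u \<otimes> s), inv s \<otimes> (v \<otimes> s)) \<in> reach Y 0"
      unfolding reach_def half_space_def
      by (rule conn[unfolded full_subgraph_connected_def, rule_format]) (use s uv in auto)
    then have "(s \<otimes> (inv s \<otimes> (u \<otimes> s)), s \<otimes> (inv s \<otimes> (v \<otimes> s))) \<in> reach Y (0 + \<eta> s)"
      by (intro reach_translate Y s)
    moreover have "s \<otimes> (inv s \<otimes> (w \<otimes> s)) = w \<otimes> s" if "w \<in> carrier G" for w
      using that s(1) by (simp add: m_assoc[symmetric])
    ultimately have "(u \<otimes> s, v \<otimes> s) \<in> reach Y (\<eta> s)"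
      using uv by simp
    then have "(u \<otimes> s, v \<otimes> s) \<in> reach X 0"
      using reach_mono[OF s(2)] by (intro Y_to_X) auto
    moreover have "(u, u \<otimes> s) \<in> reach X 0" "(v, v \<otimes> s) \<in> reach X 0"
      using reach_pow[OF X(1) t] uv reach_mono unfolding s_def by blast+
    ultimately show ?thesis
      using reach_trans reach_sym[OF X(1)] by blast
  qed
  then show ?thesis
    unfolding full_subgraph_connected_def reach_def half_space_def by blast
qed

text \<open>\<open>\<phi>\<close> carries the Cayley graph of \<open>X\<close> to that of
  \<open>\<phi>\<close> X\<open>, and the half space of\<close>\<eta> \<circ>
  \<phi>\<open>onto that of\<close>\<eta>\<open>. It remains to pass from the generators\<close>\<phi>
  \<open>X\<close> back to \<open>X\<close>.\<close>

lemma connected_automorphism: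
  assumes \<phi>: "\<phi> \<in> iso G G"
    and X: "finite X" "X \<subseteq> carrier G" "generate G X = carrier G"
    and nz: "\<exists>g\<in>carrier G. \<eta> g \<noteq> 0"
    and conn: "full_subgraph_connected (cayley_edges G X) {g \<in> carrier G. \<eta> (\<phi> g) \<ge> 0}"
  shows "full_subgraph_connected (cayley_edges G X) {g \<in> carrier G. \<eta> g \<ge> 0}"
proof (rule connected_change_generators[OF X(2,3), of "\<phi> ` X"])
  interpret phi: group_hom G G \<phi>
    using \<phi> by (intro group_hom.intro group_hom_axioms.intro is_group) (auto simp: iso_def)
  have onto: "\<phi> ` carrier G = carrier G" using \<phi> by (auto simp: iso_def bij_betw_def)
  show "finite (\<phi> ` X)" "\<phi> ` X \<subseteq> carrier G" using X by auto
  have edge: "(\<phi> u, \<phi> v) \<in> cayley_edges G (\<phi> ` X)" if uv: "(u, v) \<in> cayley_edges G X" for u v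
  proof -
    from uv obtain z where z: "u \<in> carrier G" "z \<in> X \<union> m_inv G ` X" "v = u \<otimes> z"
      by (rule cayley_edgeE)
    have zc: "z \<in> carrier G" using X(2) z(2) by (rule generators_carrier)
    have "\<phi> z \<in> \<phi> ` X \<union> m_inv G ` \<phi> ` X"
      using z(2)
    proof
      assume "z \<in> m_inv G ` X"
      then obtain x where x: "x \<in> X" "z = inv x" by blast
      then have "\<phi> z = inv (\<phi> x)" using X(2) by (simp add: subset_iff)
      with x show ?thesis by blast
    qed simp
    moreover have "\<phi> v = \<phi> u \<otimes> \<phi> z" using z(1,3) zc by simp
    moreover have "\<phi> u \<in> carrier G" using z(1) by simp
    ultimately show ?thesis unfolding cayley_edges_def by blast
  qed
  let ?H = "{g \<in> carrier G. \<eta> (\<phi> g) \<ge> 0}" and ?K = "{g \<in> carrier G. \<eta> g \<ge> 0}"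
  have map: "(\<phi> u, \<phi> v) \<in> (cayley_edges G (\<phi> ` X) \<inter> ?K \<times> ?K)\<^sup>*"
    if "(u, v) \<in> (cayley_edges G X \<inter> ?H \<times> ?H)\<^sup>*" for u v
    using that
  proof induction
    case (step v w)
    then have "(\<phi> v, \<phi> w) \<in> cayley_edges G (\<phi> ` X) \<inter> ?K \<times> ?K"
      using edge by auto
    with step.IH show ?case by (rule rtrancl_into_rtrancl)
  qed simp
  show "full_subgraph_connected (cayley_edges G (\<phi> ` X)) ?K"
    unfolding full_subgraph_connected_def
  proof (intro ballI)
    fix u v assume uv: "u \<in> ?K" "v \<in> ?K"
    then obtain u' v' where "u' \<in> carrier G" "v' \<in> carrier G" "u = \<phi> u'" "v = \<phi> v'"
      using onto by (metis (mono_tags, lifting) imageE mem_Collect_eq)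
    with uv conn map show "(u, v) \<in> (cayley_edges G (\<phi> ` X) \<inter> ?K \<times> ?K)\<^sup>*"
      unfolding full_subgraph_connected_def by blast
  qed
qed (use nz in auto)

end

text \<open>The two directions are \<open>connected_automorphism\<close> for \<open>\<phi>\<close>
  with \<open>\<xi>\<close> and for the inverse of \<open>\<phi>\<close> with \<open>\<xi>'\<close>.
  The restriction makes \<open>\<xi>'\<close> extensional, as \<open>nonzero_characters\<close>
  demands.\<close>

lemma (in group) connected_automorphism_iff:
  assumes \<xi>: "\<xi> \<in> nonzero_characters G" and \<phi>: "\<phi> \<in> iso G G"
    and X: "finite X" "X \<subseteq> carrier G" "generate G X = carrier G"
  defines "\<xi>' \<equiv> restrict (\<xi> \<circ> \<phi>) (carrier G)"
  shows "\<xi>' \<in> nonzero_characters G"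
    and "full_subgraph_connected (cayley_edges G X) {g \<in> carrier G. \<xi>' g \<ge> 0} \<longleftrightarrow>
      full_subgraph_connected (cayley_edges G X) {g \<in> carrier G. \<xi> g \<ge> 0}"
proof -
  define \<psi> where "\<psi> = inv_into (carrier G) \<phi>"
  have \<psi>: "\<psi> \<in> iso G G" unfolding \<psi>_def by (rule iso_set_sym[OF \<phi>])
  have bij: "bij_betw \<phi> (carrier G) (carrier G)" and hom: "\<phi> \<in> hom G G"
    using \<phi> by (auto simp: iso_def)
  have \<psi>c: "\<psi> g \<in> carrier G" if "g \<in> carrier G" for g
    using \<psi> that by (auto simp: iso_def hom_def)
  have \<phi>\<psi>: "\<phi> (\<psi> g) = g" if "g \<in> carrier G" for g
    unfolding \<psi>_def using bij that by (simp add: bij_betw_inv_into_right)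
  interpret real_character G \<xi>
    using \<xi> by unfold_locales (simp add: nonzero_characters_def)
  have nz: "\<exists>g\<in>carrier G. \<xi> g \<noteq> 0" using \<xi> by (simp add: nonzero_characters_def)
  have nz': "\<exists>g\<in>carrier G. \<xi>' g \<noteq> 0"
    using nz \<phi>\<psi> \<psi>c by (metis \<xi>'_def comp_apply restrict_apply')
  have char': "\<xi>' \<in> hom G real_add_group"
    using hom character by (auto simp: \<xi>'_def hom_def Pi_iff)
  show nzc: "\<xi>' \<in> nonzero_characters G"
    using char' nz' by (simp add: nonzero_characters_def \<xi>'_def)
  interpret ch': real_character G \<xi>'
    using char' by unfold_locales
  have eq: "{g \<in> carrier G. \<xi>' g \<ge> 0} = {g \<in> carrier G. \<xi> (\<phi> g) \<ge> 0}"
    by (auto simp: \<xi>'_def)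
  have eq': "{g \<in> carrier G. \<xi> g \<ge> 0} = {g \<in> carrier G. \<xi>' (\<psi> g) \<ge> 0}"
    using \<psi>c \<phi>\<psi> by (auto simp: \<xi>'_def)
  show "full_subgraph_connected (cayley_edges G X) {g \<in> carrier G. \<xi>' g \<ge> 0} \<longleftrightarrow>
      full_subgraph_connected (cayley_edges G X) {g \<in> carrier G. \<xi> g \<ge> 0}"
    using connected_automorphism[OF \<phi> X nz, folded eq]
      ch'.connected_automorphism[OF \<psi> X nz', folded eq'] by blast
qed


section \<open>Homotopy classes of paths\<close>

definition paths_between :: "'a::topological_space set \<Rightarrow> 'a \<Rightarrow> 'a \<Rightarrow> (real \<Rightarrow> 'a) set" where
  "paths_between S x y = {p. path p \<and> path_image p \<subseteq> S \<and> pathstart p = x \<and> pathfinish p = y}"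

definition path_classes :: "'a::topological_space set \<Rightarrow> 'a \<Rightarrow> 'a \<Rightarrow> (real \<Rightarrow> 'a) set set" where
  "path_classes S x y = homotopy_class S ` paths_between S x y"

definition class_join ::
    "'a::topological_space set \<Rightarrow> (real \<Rightarrow> 'a) set \<Rightarrow> (real \<Rightarrow> 'a) set \<Rightarrow> (real \<Rightarrow> 'a) set" where
  "class_join S A B = (\<Union>p\<in>A. \<Union>q\<in>B. homotopy_class S (p +++ q))"

definition class_map ::
    "'b::topological_space set \<Rightarrow> ('a \<Rightarrow> 'b) \<Rightarrow> (real \<Rightarrow> 'a::topological_space) set \<Rightarrow> (real \<Rightarrow> 'b) set" where
  "class_map T f A = (\<Union>p\<in>A. homotopy_class T (f \<circ> p))"

lemma fundamental_group_simps:
  "carrier (fundamental_group S x) = path_classes S x x"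
  "mult (fundamental_group S x) = class_join S"
  "one (fundamental_group S x) = homotopy_class S (\<lambda>t. x)"
  by (auto simp: fundamental_group_def path_classes_def paths_between_def class_join_def fun_eq_iff)

lemma homotopy_class_eqI: "homotopic_paths S p q \<Longrightarrow> homotopy_class S p = homotopy_class S q"
  unfolding homotopy_class_def using homotopic_paths_trans homotopic_paths_sym by blast

lemma homotopy_class_self: "p \<in> paths_between S x y \<Longrightarrow> p \<in> homotopy_class S p"
  by (simp add: paths_between_def homotopy_class_def)

lemma paths_between_join:
  "p \<in> paths_between S x y \<Longrightarrow> q \<in> paths_between S y z \<Longrightarrow> p +++ q \<in> paths_between S x z"
  by (auto simp: paths_between_def path_image_join)

lemma paths_between_reverse: "p \<in> paths_between S x y \<Longrightarrow> reversepath p \<in> paths_between S y x"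
  by (auto simp: paths_between_def)

lemma paths_between_const: "x \<in> S \<Longrightarrow> (\<lambda>t. x) \<in> paths_between S x x"
  by (auto simp: paths_between_def path_def path_image_def pathstart_def pathfinish_def)

lemma paths_between_endpoints: "p \<in> paths_between S x y \<Longrightarrow> x \<in> S \<and> y \<in> S"
  unfolding paths_between_def by auto

lemma paths_between_image:
  assumes "p \<in> paths_between S x y" "continuous_on S f" "f ` S \<subseteq> T"
  shows "f \<circ> p \<in> paths_between T (f x) (f y)"
proof -
  have p: "path p" "path_image p \<subseteq> S" "pathstart p = x" "pathfinish p = y"
    using assms(1) by (simp_all add: paths_between_def)
  have "path (f \<circ> p)"
    using p(1) continuous_on_subset[OF assms(2) p(2)] by (rule path_continuous_image)
  moreover have "path_image (f \<circ> p) \<subseteq> T"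
    unfolding path_image_compose using image_mono[OF p(2)] assms(3) by (rule subset_trans)
  ultimately show ?thesis
    using p(3,4) by (simp add: paths_between_def pathstart_compose pathfinish_compose)
qed

text \<open>All pairs of representatives yield the same class, and there is at least one such pair,
  so the union collapses to a single class.\<close>

lemma class_join_homotopy_class:
  assumes "p \<in> paths_between S x y" "q \<in> paths_between S y z"
  shows "class_join S (homotopy_class S p) (homotopy_class S q) = homotopy_class S (p +++ q)"
proof -
  have "homotopy_class S (p' +++ q') = homotopy_class S (p +++ q)"
    if "p' \<in> homotopy_class S p" "q' \<in> homotopy_class S q" for p' q'
  proof -
    have "homotopic_paths S p p'" "homotopic_paths S q q'"
      using that by (simp_all add: homotopy_class_def)
    then have "homotopic_paths S (p +++ q) (p' +++ q')"
      using assms by (intro homotopic_paths_join) (simp_all add: paths_between_def)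
    then show ?thesis by (rule homotopy_class_eqI[symmetric])
  qed
  with homotopy_class_self[OF assms(1)] homotopy_class_self[OF assms(2)] show ?thesis
    unfolding class_join_def by blast
qed

lemma class_map_homotopy_class:
  assumes "p \<in> paths_between S x y" "continuous_on S f" "f ` S \<subseteq> T"
  shows "class_map T f (homotopy_class S p) = homotopy_class T (f \<circ> p)"
proof -
  have "homotopy_class T (f \<circ> p') = homotopy_class T (f \<circ> p)" if "p' \<in> homotopy_class S p" for p'
  proof -
    have "homotopic_paths S p p'" using that by (simp add: homotopy_class_def)
    then have "homotopic_paths T (f \<circ> p) (f \<circ> p')"
      using assms(2,3) by (intro homotopic_paths_continuous_image) auto
    then show ?thesis by (rule homotopy_class_eqI[symmetric])
  qed
  with homotopy_class_self[OF assms(1)] show ?thesis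
    unfolding class_map_def by blast
qed

text \<open>The straight-line homotopy stays inside the convex set \<open>C\<close> and is mapped
  into \<open>S\<close> by \<open>f\<close>.\<close>

lemma homotopic_paths_convex_image:
  fixes g h :: "real \<Rightarrow> 'a::real_normed_vector" and f :: "'a \<Rightarrow> 'b::topological_space"
  assumes "convex C" "g \<in> paths_between C a b" "h \<in> paths_between C a b"
    and "continuous_on C f" "f ` C \<subseteq> S"
  shows "homotopic_paths S (f \<circ> g) (f \<circ> h)"
proof (rule homotopic_paths_continuous_image[OF _ assms(4)])
  show "homotopic_paths C g h"
    using assms(1-3) unfolding paths_between_def
    by (intro homotopic_paths_linear closed_segment_subset) (auto simp: path_image_def)
qed (use assms(5) in auto)

lemma path_classes_join:
  "A \<in> path_classes S x y \<Longrightarrow> B \<in> path_classes S y z \<Longrightarrow> class_join S A B \<in> path_classes S x z"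
  unfolding path_classes_def by (auto simp: class_join_homotopy_class paths_between_join)

lemma path_classes_const: "x \<in> S \<Longrightarrow> homotopy_class S (\<lambda>t. x) \<in> path_classes S x x"
  unfolding path_classes_def by (auto simp: paths_between_const)

lemma path_classes_map:
  "A \<in> path_classes S x y \<Longrightarrow> continuous_on S f \<Longrightarrow> f ` S \<subseteq> T \<Longrightarrow>
    class_map T f A \<in> path_classes T (f x) (f y)"
  unfolding path_classes_def by (auto simp: class_map_homotopy_class paths_between_image)

lemma class_join_assoc:
  assumes "A \<in> path_classes S x y" "B \<in> path_classes S y z" "C \<in> path_classes S z w"
  shows "class_join S (class_join S A B) C = class_join S A (class_join S B C)"
proof -
  obtain p q r where pqr: "p \<in> paths_between S x y" "q \<in> paths_between S y z" "r \<in> paths_between S z w"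
    "A = homotopy_class S p" "B = homotopy_class S q" "C = homotopy_class S r"
    using assms unfolding path_classes_def by blast
  have "homotopy_class S ((p +++ q) +++ r) = homotopy_class S (p +++ (q +++ r))"
    using pqr(1-3) unfolding paths_between_def
    by (intro homotopy_class_eqI homotopic_paths_sym[OF homotopic_paths_assoc]) auto
  moreover note pj = paths_between_join[OF pqr(1,2)] paths_between_join[OF pqr(2,3)]
  ultimately show ?thesis
    by (simp add: pqr class_join_homotopy_class[OF pqr(1,2)] class_join_homotopy_class[OF pqr(2,3)]
        class_join_homotopy_class[OF pj(1) pqr(3)] class_join_homotopy_class[OF pqr(1) pj(2)])
qed

lemma id_paths_between: "id \<in> paths_between {0..1} 0 (1::real)"
  by (auto simp: paths_between_def path_def path_image_def pathstart_def pathfinish_def)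

text \<open>The unit and inverse laws hold for the identity path of the unit interval, since the interval
  is convex, and carry over to every path \<open>p\<close> by composition with \<open>p\<close>.\<close>

lemma homotopic_paths_interval:
  assumes p: "p \<in> paths_between S x y"
    and "g \<in> paths_between {0..1} a b" "h \<in> paths_between {0..1} a b"
  shows "homotopy_class S (p \<circ> g) = homotopy_class S (p \<circ> h)"
  using p unfolding paths_between_def
  by (intro homotopy_class_eqI homotopic_paths_convex_image[OF _ assms(2,3)])
    (auto simp: path_def path_image_def)

lemma paths_between_at: "p \<in> paths_between S x y \<Longrightarrow> p 0 = x" "p \<in> paths_between S x y \<Longrightarrow> p 1 = y"
  by (auto simp: paths_between_def pathstart_def pathfinish_def)

lemma class_join_const_left:
  assumes "A \<in> path_classes S x y"
  shows "class_join S (homotopy_class S (\<lambda>t. x)) A = A"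
proof -
  obtain p where p: "p \<in> paths_between S x y" "A = homotopy_class S p"
    using assms unfolding path_classes_def by blast
  have "homotopy_class S (p \<circ> ((\<lambda>t. 0) +++ id)) = homotopy_class S (p \<circ> id)"
    by (rule homotopic_paths_interval[OF p(1)
          paths_between_join[OF paths_between_const id_paths_between] id_paths_between]) simp
  then have "homotopy_class S ((\<lambda>t. x) +++ p) = homotopy_class S p"
    by (simp add: path_compose_join paths_between_at[OF p(1)])
  moreover have "x \<in> S" using paths_between_endpoints[OF p(1)] ..
  ultimately show ?thesis
    by (simp add: p(2) class_join_homotopy_class[OF paths_between_const p(1)])
qed

lemma class_join_const_right:
  assumes "A \<in> path_classes S x y"
  shows "class_join S A (homotopy_class S (\<lambda>t. y)) = A"
proof -
  obtain p where p: "p \<in> paths_between S x y" "A = homotopy_class S p"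
    using assms unfolding path_classes_def by blast
  have "homotopy_class S (p \<circ> (id +++ (\<lambda>t. 1))) = homotopy_class S (p \<circ> id)"
    by (rule homotopic_paths_interval[OF p(1)
          paths_between_join[OF id_paths_between paths_between_const] id_paths_between]) simp
  then have "homotopy_class S (p +++ (\<lambda>t. y)) = homotopy_class S p"
    by (simp add: path_compose_join paths_between_at[OF p(1)])
  moreover have "y \<in> S" using paths_between_endpoints[OF p(1)] ..
  ultimately show ?thesis
    by (simp add: p(2) class_join_homotopy_class[OF p(1) paths_between_const])
qed

lemma class_join_inverse:
  assumes "A \<in> path_classes S x y"
  obtains B where "B \<in> path_classes S y x" "class_join S A B = homotopy_class S (\<lambda>t. x)"
    "class_join S B A = homotopy_class S (\<lambda>t. y)"
proof -
  obtain p where p: "p \<in> paths_between S x y" "A = homotopy_class S p"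
    using assms unfolding path_classes_def by blast
  note p' = paths_between_reverse[OF p(1)]
  note id = id_paths_between paths_between_reverse[OF id_paths_between]
  have "homotopy_class S (p \<circ> (id +++ reversepath id)) = homotopy_class S (p \<circ> (\<lambda>t. 0))"
    by (rule homotopic_paths_interval[OF p(1) paths_between_join[OF id] paths_between_const]) simp
  moreover have "homotopy_class S (p \<circ> (reversepath id +++ id)) = homotopy_class S (p \<circ> (\<lambda>t. 1))"
    by (rule homotopic_paths_interval[OF p(1) paths_between_join[OF id(2,1)] paths_between_const])
      simp
  ultimately have "homotopy_class S (p +++ reversepath p) = homotopy_class S (\<lambda>t. x)"
    "homotopy_class S (reversepath p +++ p) = homotopy_class S (\<lambda>t. y)"
    by (simp_all add: path_compose_join path_compose_reversepath paths_between_at[OF p(1)])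
  with p p' show ?thesis
    by (intro that[of "homotopy_class S (reversepath p)"])
      (auto simp: path_classes_def class_join_homotopy_class[OF p(1) p']
        class_join_homotopy_class[OF p' p(1)])
qed

lemma class_map_join:
  assumes "A \<in> path_classes S x y" "B \<in> path_classes S y z" "continuous_on S f" "f ` S \<subseteq> T"
  shows "class_map T f (class_join S A B) = class_join T (class_map T f A) (class_map T f B)"
proof -
  obtain p q where pq: "p \<in> paths_between S x y" "q \<in> paths_between S y z"
    "A = homotopy_class S p" "B = homotopy_class S q"
    using assms unfolding path_classes_def by blast
  show ?thesis
    using class_join_homotopy_class[OF paths_between_image[OF pq(1) assms(3,4)]
        paths_between_image[OF pq(2) assms(3,4)]]
    by (simp add: pq class_join_homotopy_class[OF pq(1,2)] path_compose_join
        class_map_homotopy_class[OF _ assms(3,4), OF pq(1)]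
        class_map_homotopy_class[OF _ assms(3,4), OF pq(2)]
        class_map_homotopy_class[OF _ assms(3,4), OF paths_between_join[OF pq(1,2)]])
qed

lemma class_map_inverse:
  assumes "A \<in> path_classes S x y" "continuous_on S f" "f ` S \<subseteq> T" "continuous_on T g" "g ` T \<subseteq> S"
    and "g \<circ> f = id"
  shows "class_map S g (class_map T f A) = A"
proof -
  obtain p where p: "p \<in> paths_between S x y" "A = homotopy_class S p"
    using assms unfolding path_classes_def by blast
  show ?thesis
    using assms(6)
    by (simp add: p class_map_homotopy_class[OF p(1) assms(2,3)]
        class_map_homotopy_class[OF paths_between_image[OF p(1) assms(2,3)] assms(4,5)] o_assoc)
qed

lemma group_fundamental_group:
  assumes "x \<in> S"
  shows "group (fundamental_group S x)"
proof (rule groupI, unfold fundamental_group_simps)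
  show "\<exists>B\<in>path_classes S x x. class_join S B A = homotopy_class S (\<lambda>t. x)"
    if "A \<in> path_classes S x x" for A
    using class_join_inverse[OF that] by metis
qed (blast intro: path_classes_join path_classes_const assms
    | (rule class_join_assoc class_join_const_left; assumption))+

section \<open>Automorphisms of the fundamental group from homeomorphisms that move the base
  point\<close>

definition transport ::
    "'a::topological_space set \<Rightarrow> ('a \<Rightarrow> 'a) \<Rightarrow> (real \<Rightarrow> 'a) set \<Rightarrow> (real \<Rightarrow> 'a) set \<Rightarrow>
     (real \<Rightarrow> 'a) set \<Rightarrow> (real \<Rightarrow> 'a) set" where
  "transport S f C C' A = class_join S C (class_join S (class_map S f A) C')"

text \<open>\<open>transport\<close> applies the map induced by \<open>f\<close> and then changes
  the base point from \<open>f x\<close> back to \<open>x\<close> along \<open>C\<close>. Products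
  are respected because \<open>C'\<close> followed by \<open>C\<close> cancels between the two
  images.\<close>

lemma transport_hom:
  assumes f: "continuous_on S f" "f ` S \<subseteq> S"
    and C: "C \<in> path_classes S x (f x)" "C' \<in> path_classes S (f x) x"
      "class_join S C' C = homotopy_class S (\<lambda>t. f x)"
  shows "transport S f C C' \<in> hom (fundamental_group S x) (fundamental_group S x)"
proof (rule homI, unfold fundamental_group_simps)
  note [intro] = path_classes_join path_classes_map[OF _ f] C(1,2)
  note assoc = class_join_assoc[where S = S]
  fix A assume A: "A \<in> path_classes S x x"
  show "transport S f C C' A \<in> path_classes S x x" unfolding transport_def using A by blast
  fix B assume B: "B \<in> path_classes S x x"
  note fAB = path_classes_map[OF A f] path_classes_map[OF B f]
  note fBC = path_classes_join[OF fAB(2) C(2)]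
  show "transport S f C C' (class_join S A B) =
      class_join S (transport S f C C' A) (transport S f C C' B)"
    unfolding transport_def class_map_join[OF A B f]
    by (simp add: assoc[OF C(1) path_classes_join[OF fAB(1) C(2)] path_classes_join[OF C(1) fBC]]
        assoc[OF fAB(1) C(2) path_classes_join[OF C(1) fBC]] assoc[OF C(2) C(1) fBC, symmetric]
        C(3) class_join_const_left[OF fBC] assoc[OF fAB(1) fAB(2) C(2)])
qed

lemma transport_iso:
  assumes f: "continuous_on S f" "f ` S \<subseteq> S" and g: "continuous_on S g" "g ` S \<subseteq> S"
    and fg: "f \<circ> g = id" "g \<circ> f = id"
    and C: "C \<in> path_classes S x (f x)" "C' \<in> path_classes S (f x) x"
      "class_join S C' C = homotopy_class S (\<lambda>t. f x)"
      "class_join S C C' = homotopy_class S (\<lambda>t. x)"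
  shows "transport S f C C' \<in> iso (fundamental_group S x) (fundamental_group S x)"
proof (rule isoI[OF transport_hom[OF f C(1-3)]], unfold fundamental_group_simps)
  note assoc = class_join_assoc[where S = S]
  \<comment> \<open>The inverse undoes the two stages in reverse order: conjugation with
    \<open>C\<close> moves the loop to \<open>f x\<close>, then \<open>g\<close> takes it back to
    \<open>x\<close>.\<close>
  define \<psi> where "\<psi> A = class_map S g (class_join S C' (class_join S A C))" for A
  have gf: "g (f x) = x" using fg by (metis comp_apply id_apply)
  show "bij_betw (transport S f C C') (path_classes S x x) (path_classes S x x)"
  proof (rule bij_betw_byWitness[where f' = \<psi>])
    have conj: "class_join S C' (class_join S A C) \<in> path_classes S (f x) (f x)"
      if "A \<in> path_classes S x x" for A
      using that C by (blast intro: path_classes_join)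
    have tr: "transport S f C C' A \<in> path_classes S x x" if "A \<in> path_classes S x x" for A
      unfolding transport_def using that C by (blast intro: path_classes_join path_classes_map[OF _ f])
    show "transport S f C C' ` path_classes S x x \<subseteq> path_classes S x x" using tr by blast
    show "\<psi> ` path_classes S x x \<subseteq> path_classes S x x"
      unfolding \<psi>_def using path_classes_map[OF conj g] by (auto simp: gf)
    show "\<forall>A\<in>path_classes S x x. transport S f C C' (\<psi> A) = A"
    proof
      fix A assume A: "A \<in> path_classes S x x"
      note AC = path_classes_join[OF A C(1)]
      have "class_map S f (\<psi> A) = class_join S C' (class_join S A C)"
        unfolding \<psi>_def by (rule class_map_inverse[OF conj[OF A] g f fg(1)])
      then show "transport S f C C' (\<psi> A) = A"
        unfolding transport_def
        by (simp add: assoc[OF C(2) AC C(2)] assoc[OF A C(1,2)] C(4) class_join_const_right[OF A]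
            assoc[OF C(1,2) A, symmetric] class_join_const_left[OF A])
    qed
    show "\<forall>A\<in>path_classes S x x. \<psi> (transport S f C C' A) = A"
    proof
      fix A assume A: "A \<in> path_classes S x x"
      note fA = path_classes_map[OF A f]
      note fAC = path_classes_join[OF fA C(2)]
      have "class_join S C' (class_join S (transport S f C C' A) C) = class_map S f A"
        unfolding transport_def
        by (simp add: assoc[OF C(1) fAC C(1)] assoc[OF fA C(2,1)] C(3) class_join_const_right[OF fA]
            assoc[OF C(2,1) fA, symmetric] class_join_const_left[OF fA])
      then show "\<psi> (transport S f C C' A) = A"
        unfolding \<psi>_def by (simp add: class_map_inverse[OF A f g fg(2)])
    qed
  qed
qed

text \<open>Transports along different paths differ by an inner automorphism.\<close>

lemma character_transport:
  assumes f: "continuous_on S f" "f ` S \<subseteq> S"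
    and C: "C \<in> path_classes S x (f x)" "C' \<in> path_classes S (f x) x"
      "class_join S C' C = homotopy_class S (\<lambda>t. f x)"
    and D: "D \<in> path_classes S x (f x)" "D' \<in> path_classes S (f x) x"
      "class_join S D' D = homotopy_class S (\<lambda>t. f x)"
    and \<xi>: "\<xi> \<in> hom (fundamental_group S x) real_add_group"
    and A: "A \<in> path_classes S x x"
  shows "\<xi> (transport S f C C' A) = \<xi> (transport S f D D' A)"
proof -
  note assoc = class_join_assoc[where S = S]
  have add: "\<xi> (class_join S P Q) = \<xi> P + \<xi> Q"
    if "P \<in> path_classes S x x" "Q \<in> path_classes S x x" for P Q
    using hom_mult[OF \<xi>] that by (simp add: fundamental_group_simps real_add_group_def)
  \<comment> \<open>The loop \<open>E\<close> goes out along \<open>D\<close> and returns along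
    \<open>C'\<close>. It conjugates one transport into the other, and its value cancels because
    \<open>\<xi>\<close> is additive.\<close>
  define E where "E = class_join S D C'"
  have E: "E \<in> path_classes S x x" unfolding E_def by (rule path_classes_join[OF D(1) C(2)])
  have tr: "transport S f C C' A \<in> path_classes S x x" "transport S f D D' A \<in> path_classes S x x"
    unfolding transport_def using A C D by (blast intro: path_classes_join path_classes_map[OF _ f])+
  note fA = path_classes_map[OF A f]
  note fAC = path_classes_join[OF fA C(2)] and fAD = path_classes_join[OF fA D(2)]
  have "class_join S E (transport S f C C' A) = class_join S D (class_join S (class_map S f A) C')"
    unfolding E_def transport_def
    by (simp add: assoc[OF D(1) C(2) path_classes_join[OF C(1) fAC]] assoc[OF C(2,1) fAC, symmetric]
        C(3) class_join_const_left[OF fAC])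
  also have "\<dots> = class_join S (transport S f D D' A) E"
    unfolding E_def transport_def
    by (simp add: assoc[OF D(1) fAD E[unfolded E_def]] assoc[OF fA D(2) E[unfolded E_def]]
        assoc[OF D(2,1) C(2), symmetric] D(3) class_join_const_left[OF C(2)])
  finally have "\<xi> (class_join S E (transport S f C C' A)) = \<xi> (class_join S (transport S f D D' A) E)"
    by simp
  then show ?thesis using add E tr by simp
qed

text \<open>Going along the left and top side or along the bottom and right side gives homotopic paths,
  since the square is convex.\<close>

lemma square_transport:
  fixes F :: "real \<times> real \<Rightarrow> 'a::topological_space"
  assumes F: "continuous_on ({0..1} \<times> {0..1}) F" "F ` ({0..1} \<times> {0..1}) \<subseteq> S"
    and sides: "\<And>s. s \<in> {0..1} \<Longrightarrow> F (s, 1) = F (s, 0)"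
    and C': "C' \<in> path_classes S (F (1, 0)) (F (0, 0))"
      "class_join S (homotopy_class S (\<lambda>s. F (s, 0))) C' = homotopy_class S (\<lambda>t. F (0, 0))"
  shows "homotopy_class S (\<lambda>t. F (0, t)) =
    class_join S (homotopy_class S (\<lambda>s. F (s, 0)))
      (class_join S (homotopy_class S (\<lambda>t. F (1, t))) C')"
proof -
  let ?Q = "{0..1::real} \<times> {0..1::real}"
  define l b r t :: "real \<Rightarrow> real \<times> real" where "l = (\<lambda>t. (0, t))" and "b = (\<lambda>s. (s, 0))"
    and "r = (\<lambda>t. (1, t))" and "t = (\<lambda>s. (s, 1))"
  have Q: "l \<in> paths_between ?Q (0, 0) (0, 1)" "b \<in> paths_between ?Q (0, 0) (1, 0)"
    "r \<in> paths_between ?Q (1, 0) (1, 1)" "t \<in> paths_between ?Q (0, 1) (1, 1)"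
    by (auto simp: paths_between_def l_def b_def r_def t_def path_def path_image_def pathstart_def
        pathfinish_def intro!: continuous_intros)
  have same: "F (0, 1) = F (0, 0)" "F (1, 1) = F (1, 0)" using sides by auto
  note FQ = Q[THEN paths_between_image[OF _ F]]
  have cls: "homotopy_class S (F \<circ> l) \<in> path_classes S (F (0, 0)) (F (0, 0))"
    "homotopy_class S (F \<circ> b) \<in> path_classes S (F (0, 0)) (F (1, 0))"
    "homotopy_class S (F \<circ> r) \<in> path_classes S (F (1, 0)) (F (1, 0))"
    using FQ same by (auto simp: path_classes_def)
  have eqs: "F \<circ> b = (\<lambda>s. F (s, 0))" "F \<circ> l = (\<lambda>t. F (0, t))" "F \<circ> r = (\<lambda>t. F (1, t))"
    by (auto simp: b_def l_def r_def)
  note cls' = cls[unfolded eqs]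
  have tb: "homotopy_class S (F \<circ> t) = homotopy_class S (F \<circ> b)"
    using FQ(4) unfolding paths_between_def
    by (intro homotopy_class_eqI homotopic_paths_eq) (auto simp: t_def b_def sides)
  have "convex ?Q" by (intro convex_Times convex_real_interval)
  then have "homotopy_class S (F \<circ> (l +++ t)) = homotopy_class S (F \<circ> (b +++ r))"
    by (intro homotopy_class_eqI homotopic_paths_convex_image[OF _ paths_between_join[OF Q(1,4)]
          paths_between_join[OF Q(2,3)] F])
  then have "class_join S (homotopy_class S (F \<circ> l)) (homotopy_class S (F \<circ> t)) =
      class_join S (homotopy_class S (F \<circ> b)) (homotopy_class S (F \<circ> r))"
    by (simp add: path_compose_join class_join_homotopy_class[OF FQ(1,4)]
        class_join_homotopy_class[OF FQ(2,3)])
  \<comment> \<open>Appending \<open>C'\<close> cancels the bottom side on the left-hand side, where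
    top and bottom already represent the same class.\<close>
  then have "class_join S (class_join S (homotopy_class S (F \<circ> l)) (homotopy_class S (F \<circ> b))) C' =
      class_join S (class_join S (homotopy_class S (F \<circ> b)) (homotopy_class S (F \<circ> r))) C'"
    by (simp add: tb)
  then show ?thesis
    using C' by (simp add: eqs class_join_assoc[OF cls'(1,2) C'(1)]
        class_join_assoc[OF cls'(2,3) C'(1)] class_join_const_right[OF cls'(1)])
qed


section \<open>Moving base points on the Klein bottle\<close>

lemma continuous_on_abs_klein: "continuous_on UNIV abs_klein"
  by (rule continuous_on_open_vimage[THEN iffD2, rule_format]) (auto simp: open_klein_def)

lemma abs_klein_eqE:
  assumes "abs_klein (x, y) = abs_klein (x', y')"
  obtains m k :: int where "x' = x + m" "y' = (if even m then y else - y) + k"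
  using assms unfolding klein.abs_eq_iff klein_rel_def by auto

lemma abs_klein_vertical: "abs_klein (x, y) = abs_klein (x, y') \<longleftrightarrow> y' - y \<in> \<int>"
proof
  assume "abs_klein (x, y) = abs_klein (x, y')"
  then show "y' - y \<in> \<int>" by (rule abs_klein_eqE) auto
next
  assume "y' - y \<in> \<int>"
  then obtain k :: int where "y' = y + k" by (metis Ints_cases add.commute diff_add_cancel)
  then show "abs_klein (x, y) = abs_klein (x, y')"
    unfolding klein.abs_eq_iff klein_rel_def by (intro exI[of _ 0] exI[of _ k]) simp
qed

text \<open>First coordinates of equivalent points differ by an integer.\<close>

lemma abs_klein_horizontal:
  assumes "x \<noteq> x'" "\<bar>x - x'\<bar> < 1"
  shows "abs_klein (x, y) \<noteq> abs_klein (x', y')"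
proof
  assume "abs_klein (x, y) = abs_klein (x', y')"
  then obtain m k :: int where "x' = x + m" by (rule abs_klein_eqE)
  with assms show False by auto
qed

lemma abs_klein_b: "abs_klein (1, - y) = abs_klein (0, y)"
  unfolding klein.abs_eq_iff klein_rel_def by (intro exI[of _ "-1"] exI[of _ 0]) simp

text \<open>The loop \<open>t \<mapsto> (t, h (1 - 2 t))\<close> meets each vertical circle exactly once.\<close>

lemma abs_klein_slanted:
  assumes "0 \<le> t" "t \<le> 1" "0 \<le> x" "x < 1" "0 < u" "u < 1"
  shows "abs_klein (t, h * (1 - 2 * t)) \<noteq> abs_klein (x, h * (1 - 2 * x) + u)"
proof
  assume eq: "abs_klein (t, h * (1 - 2 * t)) = abs_klein (x, h * (1 - 2 * x) + u)"
  show False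
  \<comment> \<open>For \<open>t = 1\<close> and \<open>x = 0\<close> the first coordinates differ
    by exactly 1, which \<open>abs_klein_horizontal\<close> does not cover. The end point
    \<open>(1, - h)\<close> is therefore replaced by the equivalent point
    \<open>(0, h)\<close>.\<close>
  proof (cases "t = 1")
    case True
    then have eq0: "abs_klein (0, h) = abs_klein (x, h * (1 - 2 * x) + u)"
      using eq abs_klein_b[of h] by simp
    with assms have x: "x = 0" using abs_klein_horizontal[of 0 x] by fastforce
    with eq0 have "u \<in> \<int>" by (simp add: abs_klein_vertical)
    with assms show False by (auto elim: Ints_cases)
  next
    case False
    with eq assms have x: "x = t" using abs_klein_horizontal[of t x] by fastforce
    with eq have "u \<in> \<int>" by (simp add: abs_klein_vertical)
    with assms show False by (auto elim: Ints_cases)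
  qed
qed

text \<open>The numerators differ by a nonzero integer of absolute value less than
  \<open>n + 1\<close>, which is no multiple of \<open>n + 1\<close>.\<close>

lemma base_height_diff:
  assumes "i \<in> {1..n}" "j \<in> {1..n}" "i \<noteq> j"
  shows "base_height n i - base_height n j \<notin> \<int>"
proof
  assume "base_height n i - base_height n j \<in> \<int>"
  then obtain m :: int where "base_height n i - base_height n j = m" by (auto elim: Ints_cases)
  then have "(real i - real j) / real (n + 1) = m" by (simp add: base_height_def diff_divide_distrib)
  then have "real i - real j = m * real (n + 1)" by (simp add: field_simps)
  then have "(of_int (int i - int j) :: real) = of_int (m * int (n + 1))" by simp
  then have eq: "int i - int j = m * int (n + 1)" unfolding of_int_eq_iff .
  have "\<bar>int i - int j\<bar> < int (n + 1)" using assms by auto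
  then have "m = 0" unfolding eq abs_mult
    by (smt (verit) mult_le_cancel_right1 of_nat_0_le_iff)
  with eq assms show False by simp
qed

section \<open>The configuration space and relabelling of its points\<close>

lemma base_config_in_configuration_space: "base_config n \<in> configuration_space n"
proof -
  have "base_config n i \<noteq> base_config n j" if "i \<in> {1..n}" "j \<in> {1..n}" "i \<noteq> j" for i j
    using base_height_diff[of j n i] that by (simp add: base_config_def abs_klein_vertical)
  then show ?thesis by (auto simp: configuration_space_def base_config_def)
qed

lemma configuration_space_permute:
  assumes "\<tau> permutes {1..n}" "x \<in> configuration_space n"
  shows "x \<circ> \<tau> \<in> configuration_space n"
proof -
  have x: "\<And>i. i \<notin> {1..n} \<Longrightarrow> x i = undefined"
    "\<And>i j. i \<in> {1..n} \<Longrightarrow> j \<in> {1..n} \<Longrightarrow> i \<noteq> j \<Longrightarrow> x i \<noteq> x j"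
    using assms(2) by (auto simp: configuration_space_def PiE_def extensional_def)
  have "x (\<tau> i) \<noteq> x (\<tau> j)" if "i \<in> {1..n}" "j \<in> {1..n}" "i \<noteq> j" for i j
    using that permutes_in_image[OF assms(1)] permutes_inj[OF assms(1)]
    by (intro x(2)) (auto dest: injD)
  moreover have "x (\<tau> i) = undefined" if "i \<notin> {1..n}" for i
    using x(1) that permutes_not_in[OF assms(1)] by simp
  ultimately show ?thesis
    unfolding configuration_space_def by (simp add: PiE_iff extensional_def)
qed

lemma continuous_on_permute: "continuous_on A (\<lambda>x::nat \<Rightarrow> klein. x \<circ> \<tau>)"
  unfolding comp_def
  by (intro continuous_on_coordinatewise_then_product
      continuous_on_subset[OF continuous_on_product_coordinates]) simp

section \<open>The loops \<open>b_path\<close> and the square that moves them\<close>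

definition b_path :: "nat \<Rightarrow> nat \<Rightarrow> real \<Rightarrow> nat \<Rightarrow> klein" where
  "b_path n i t = (base_config n)(i := b_loop n i t)"

lemma b_braid_eq: "b_braid n i = homotopy_class (configuration_space n) (b_path n i)"
  by (simp add: b_braid_def b_path_def[abs_def])

lemma b_loop_eq: "b_loop n i t = abs_klein (t, base_height n i * (1 - 2 * t))"
  by (simp add: b_loop_def linepath_def algebra_simps)

text \<open>While the \<open>k\<close>-th base point moves from height \<open>h\<^sub>k\<close> to \<open>h\<^bsub>\<tau> k\<^esub>\<close> on the circle
  \<open>{0} \<times> \<real>\<close>, the loop \<open>t \<mapsto> (t, h (1 - 2 t))\<close> at the current height \<open>h\<close> cuts the Klein bottle
  open. In its complement the points are \<open>(x, h (1 - 2 x) + u)\<close> with \<open>0 \<le> x < 1\<close> and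
  \<open>0 < u < 1\<close>. The remaining base points are permuted in these coordinates, on arcs
  \<open>x = c\<^sub>j s (1 - s)\<close> that are kept apart by different factors \<open>c\<^sub>j\<close>.\<close>

lemma b_path_square:
  assumes \<tau>: "\<tau> permutes {1..n}" and k: "k \<in> {1..n}"
  obtains F :: "real \<times> real \<Rightarrow> nat \<Rightarrow> klein" where
    "continuous_on ({0..1} \<times> {0..1}) F" "F ` ({0..1} \<times> {0..1}) \<subseteq> configuration_space n"
    "\<And>s. F (s, 1) = F (s, 0)"
    "\<And>t. F (0, t) = b_path n k t" "\<And>t. F (1, t) = b_path n (\<tau> k) t \<circ> \<tau>"
proof -
  define H where "H = base_height n"
  define h where "h s = (1 - s) * H k + s * H (\<tau> k)" for s
  \<comment> \<open>\<open>frac\<close> selects the height of the \<open>j\<close>-th point above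
    the \<open>k\<close>-th one that lies strictly between 0 and 1, at the start and at the end.
    Convex combinations stay in this interval, so the point never crosses the loop.\<close>
  define u where "u j s = (1 - s) * frac (H j - H k) + s * frac (H (\<tau> j) - H (\<tau> k))" for j s
  \<comment> \<open>Dividing by \<open>n + 1\<close> keeps the arcs inside the strip
    \<open>x < 1\<close>.\<close>
  define c where "c j = real j / real (n + 1)" for j
  define x where "x j s = c j * (s * (1 - s))" for j s
  \<comment> \<open>The parameter \<open>t\<close> moves only the \<open>k\<close>-th point along
    its loop; the others depend on \<open>s\<close> alone.\<close>
  define P where "P j = (\<lambda>(s, t). if j = k then (t, h s * (1 - 2 * t))
    else (x j s, h s * (1 - 2 * x j s) + u j s))" for j
  define F where "F z = (\<lambda>j\<in>{1..n}. abs_klein (P j z))" for z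
  have \<tau>_in: "\<tau> j \<in> {1..n}" if "j \<in> {1..n}" for j
    using that permutes_in_image[OF \<tau>] by blast
  have \<tau>_inj: "\<tau> i \<noteq> \<tau> j" if "i \<noteq> j" for i j
    using that permutes_inj[OF \<tau>] by (auto dest: injD)
  have shift: "abs_klein (0, y + frac (z - y)) = abs_klein (0, z)" for y z
    by (simp add: abs_klein_vertical frac_def)
  have F0: "F (0, t) j = base_config n j" if "j \<in> {1..n}" "j \<noteq> k" for j t
    using that by (simp add: F_def P_def x_def h_def u_def shift base_config_def H_def)
  have F1: "F (1, t) j = base_config n (\<tau> j)" if "j \<in> {1..n}" "j \<noteq> k" for j t
    using that \<tau>_in[OF that(1)]
    by (simp add: F_def P_def x_def h_def u_def shift base_config_def H_def)
  have base_inj: "base_config n i \<noteq> base_config n j"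
    if "i \<in> {1..n}" "j \<in> {1..n}" "i \<noteq> j" for i j
    using base_config_in_configuration_space[of n] that by (simp add: configuration_space_def)
  have u01: "0 < u j s" "u j s < 1" if "j \<in> {1..n}" "j \<noteq> k" "s \<in> {0..1}" for j s
  proof -
    have "frac (H j - H k) \<in> {0<..<1}" "frac (H (\<tau> j) - H (\<tau> k)) \<in> {0<..<1}"
      using base_height_diff[OF that(1) k that(2)]
        base_height_diff[OF \<tau>_in[OF that(1)] \<tau>_in[OF k] \<tau>_inj[OF that(2)]]
      by (auto simp: H_def frac_lt_1 frac_gt_0_iff)
    then have "u j s \<in> {0<..<1}"
      using convexD_alt[OF convex_real_interval(8), of _ 0 1 _ s] that(3) by (simp add: u_def)
    then show "0 < u j s" "u j s < 1" by auto
  qed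
  have x01: "0 \<le> x j s" "x j s < 1" if "j \<in> {1..n}" "s \<in> {0..1}" for j s
  proof -
    have "0 \<le> c j" "c j < 1" using that(1) by (auto simp: c_def)
    moreover have "0 \<le> s * (1 - s)" "s * (1 - s) \<le> 1"
      using that(2) by (auto intro: mult_le_one)
    ultimately show "0 \<le> x j s" "x j s < 1"
      unfolding x_def using mult_left_le[of "s * (1 - s)" "c j"] by auto
  qed
  have apart_k: "F (s, t) k \<noteq> F (s, t) j"
    if "j \<in> {1..n}" "j \<noteq> k" "s \<in> {0..1}" "t \<in> {0..1}" for j s t
    using abs_klein_slanted[of t "x j s" "u j s" "h s"] that k u01[OF that(1-3)] x01[OF that(1,3)]
    by (simp add: F_def P_def)
  have apart: "F (s, t) i \<noteq> F (s, t) j"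
    if ij: "i \<in> {1..n}" "j \<in> {1..n}" "i \<noteq> k" "j \<noteq> k" "i \<noteq> j" and s: "s \<in> {0..1}" for i j s t
  \<comment> \<open>At both ends all arcs return to \<open>x = 0\<close>, so their first coordinates
    no longer separate the points; there the base configuration and its relabelling do.\<close>
  proof (cases "s = 0 \<or> s = 1")
    case True
    then show ?thesis
      using F0 F1 ij base_inj[of i j] base_inj[OF \<tau>_in \<tau>_in \<tau>_inj, of i j] by auto
  next
    case False
    then have "s * (1 - s) \<noteq> 0" by auto
    with ij have "x i s \<noteq> x j s" by (simp add: x_def c_def)
    moreover have "\<bar>x i s - x j s\<bar> < 1" using x01[OF ij(1) s] x01[OF ij(2) s] by linarith
    ultimately show ?thesis
      using abs_klein_horizontal[of "x i s" "x j s"] ij by (simp add: F_def P_def)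
  qed
  show thesis
  proof
    show "continuous_on ({0..1} \<times> {0..1}) F"
    proof (rule continuous_on_coordinatewise_then_product)
      fix j
      have "continuous_on ({0..1} \<times> {0..1}) (P j)"
        unfolding P_def h_def u_def x_def case_prod_beta
        by (cases "j = k") (simp_all, (intro continuous_intros)+)
      then have "continuous_on ({0..1} \<times> {0..1}) (\<lambda>z. abs_klein (P j z))"
        by (rule continuous_on_compose2[OF continuous_on_abs_klein]) simp
      then show "continuous_on ({0..1} \<times> {0..1}) (\<lambda>z. F z j)"
        unfolding F_def restrict_def by (cases "j \<in> {1..n}")
          (simp_all only: if_True if_False continuous_on_const)
    qed
    show "F ` ({0..1} \<times> {0..1}) \<subseteq> configuration_space n"
    proof clarify
      fix s t :: real assume st: "s \<in> {0..1}" "t \<in> {0..1}"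
      have "F (s, t) i \<noteq> F (s, t) j" if "i \<in> {1..n}" "j \<in> {1..n}" "i \<noteq> j" for i j
        using apart[OF that(1,2) _ _ that(3) st(1)] apart_k[OF that(1) _ st]
          apart_k[OF that(2) _ st] that(3) by metis
      then show "F (s, t) \<in> configuration_space n"
        by (simp add: configuration_space_def F_def)
    qed
    show "F (s, 1) = F (s, 0)" for s
      by (simp add: F_def P_def fun_eq_iff abs_klein_b)
    show "F (0, t) = b_path n k t" for t
    proof
      fix j show "F (0, t) j = b_path n k t j"
        using F0[of j t] k
        by (cases "j = k"; cases "j \<in> {1..n}")
          (auto simp: b_path_def b_loop_eq F_def P_def h_def H_def base_config_def)
    qed
    show "F (1, t) = b_path n (\<tau> k) t \<circ> \<tau>" for t
    proof
      fix j
      have "\<tau> j = \<tau> k \<longleftrightarrow> j = k" using \<tau>_inj by blast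
      moreover have "\<tau> j = j" if "j \<notin> {1..n}" using permutes_not_in[OF \<tau> that] .
      ultimately show "F (1, t) j = (b_path n (\<tau> k) t \<circ> \<tau>) j"
        using F1[of j t] k
        by (cases "j = k"; cases "j \<in> {1..n}")
          (auto simp: b_path_def b_loop_eq F_def P_def h_def H_def base_config_def)
    qed
  qed
qed

section \<open>The relabelling automorphism of the pure braid group and its effect on
  characters\<close>

lemma group_pure_braid_group: "group (pure_braid_group n)"
  unfolding pure_braid_group_def
  by (rule group_fundamental_group[OF base_config_in_configuration_space])

text \<open>\<open>b_path n i\<close> is the left side of the square for the identity permutation,
  which already provides continuity and disjointness of the strings.\<close>

lemma b_path_loop:
  assumes "i \<in> {1..n}"
  shows "b_path n i \<in> paths_between (configuration_space n) (base_config n) (base_config n)"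
proof -
  obtain F :: "real \<times> real \<Rightarrow> nat \<Rightarrow> klein" where F:
    "continuous_on ({0..1} \<times> {0..1}) F" "F ` ({0..1} \<times> {0..1}) \<subseteq> configuration_space n"
    "\<And>t. F (0, t) = b_path n i t"
    using b_path_square[OF permutes_id assms] by metis
  have "F \<circ> Pair 0 = b_path n i" using F(3) by auto
  moreover have "Pair (0::real) \<in> paths_between ({0..1} \<times> {0..1}) (0, 0) (0, 1::real)"
    by (auto simp: paths_between_def path_def path_image_def pathstart_def pathfinish_def
        intro!: continuous_intros)
  ultimately have "b_path n i \<in> paths_between (configuration_space n) (F (0, 0)) (F (0, 1))"
    using paths_between_image[OF _ F(1,2)] by metis
  moreover have "b_path n i 0 = base_config n" "b_path n i 1 = base_config n"
    using assms by (auto simp: b_path_def b_loop_eq base_config_def fun_eq_iff abs_klein_b)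
  ultimately show ?thesis by (simp add: F(3))
qed

lemma b_braid_carrier: "i \<in> {1..n} \<Longrightarrow> b_braid n i \<in> carrier (pure_braid_group n)"
  unfolding pure_braid_group_def fundamental_group_simps path_classes_def b_braid_eq
  using b_path_loop by blast

text \<open>Relabelling by \<open>\<tau>\<close> turns \<open>b_path n (\<tau> k)\<close> into a
  motion of the \<open>k\<close>-th point, the right side of the square whose left side is
  \<open>b_path n k\<close>. The bottom side serves as \<open>C\<close>, so the path depends on
  \<open>k\<close>.\<close>

lemma b_braid_transport:
  assumes \<tau>: "\<tau> permutes {1..n}" and k: "k \<in> {1..n}"
  defines "S \<equiv> configuration_space n" and "x \<equiv> base_config n"
  obtains C C' where "C \<in> path_classes S x (x \<circ> \<tau>)" "C' \<in> path_classes S (x \<circ> \<tau>) x"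
    "class_join S C' C = homotopy_class S (\<lambda>t. x \<circ> \<tau>)"
    "class_join S C C' = homotopy_class S (\<lambda>t. x)"
    "transport S (\<lambda>y. y \<circ> \<tau>) C C' (b_braid n (\<tau> k)) = b_braid n k"
proof -
  obtain F :: "real \<times> real \<Rightarrow> nat \<Rightarrow> klein" where F:
    "continuous_on ({0..1} \<times> {0..1}) F" "F ` ({0..1} \<times> {0..1}) \<subseteq> S"
    "\<And>s. F (s, 1) = F (s, 0)"
    "\<And>t. F (0, t) = b_path n k t" "\<And>t. F (1, t) = b_path n (\<tau> k) t \<circ> \<tau>"
    unfolding S_def using b_path_square[OF \<tau> k] by metis
  have \<tau>k: "\<tau> k \<in> {1..n}" using k permutes_in_image[OF \<tau>] by blast
  have at0: "b_path n i 0 = x" if "i \<in> {1..n}" for i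
    unfolding x_def using b_path_loop[OF that] by (rule paths_between_at)
  have corners: "F (0, 0) = x" "F (1, 0) = x \<circ> \<tau>" by (simp_all add: F(4,5) at0[OF k] at0[OF \<tau>k])
  define C where "C = homotopy_class S (\<lambda>s. F (s, 0))"
  have "(\<lambda>s. (s, 0)) \<in> paths_between ({0..1} \<times> {0..1}) (0, 0) (1::real, 0::real)"
    by (auto simp: paths_between_def path_def path_image_def pathstart_def pathfinish_def
        intro!: continuous_intros)
  from paths_between_image[OF this F(1,2)]
  have C: "C \<in> path_classes S x (x \<circ> \<tau>)"
    unfolding C_def path_classes_def corners comp_def by blast
  obtain C' where C': "C' \<in> path_classes S (x \<circ> \<tau>) x" "class_join S C C' = homotopy_class S (\<lambda>t. x)"
    "class_join S C' C = homotopy_class S (\<lambda>t. x \<circ> \<tau>)"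
    using class_join_inverse[OF C] by blast
  have "homotopy_class S (\<lambda>t. F (0, t)) =
    class_join S C (class_join S (homotopy_class S (\<lambda>t. F (1, t))) C')"
    unfolding C_def
    by (rule square_transport[OF F(1,2)]) (use C' in \<open>simp_all add: F(3) corners C_def\<close>)
  moreover have "(\<lambda>t. F (1, t)) = (\<lambda>y. y \<circ> \<tau>) \<circ> b_path n (\<tau> k)" by (simp add: F(5) comp_def)
  moreover have "class_map S (\<lambda>y. y \<circ> \<tau>) (b_braid n (\<tau> k)) =
      homotopy_class S ((\<lambda>y. y \<circ> \<tau>) \<circ> b_path n (\<tau> k))"
    unfolding b_braid_eq S_def
    by (rule class_map_homotopy_class[OF b_path_loop[OF \<tau>k] continuous_on_permute])
      (use configuration_space_permute[OF \<tau>] in blast)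
  ultimately have "transport S (\<lambda>y. y \<circ> \<tau>) C C' (b_braid n (\<tau> k)) = b_braid n k"
    by (simp add: transport_def b_braid_eq[of n k] S_def[symmetric] F(4))
  with C C' show thesis using that by blast
qed

text \<open>\<open>\<xi>'\<close> is \<open>\<xi>\<close> composed with a single automorphism, the
  transport along the path belonging to index 1. For each \<open>k\<close> its value is computed
  along the path adapted to \<open>k\<close>, which is legitimate by
  \<open>character_transport\<close>.\<close>

lemma permuted_character:
  assumes n: "n \<ge> 1" and \<tau>: "\<tau> permutes {1..n}"
    and X: "finite X" "X \<subseteq> carrier (pure_braid_group n)"
      "generate (pure_braid_group n) X = carrier (pure_braid_group n)"
    and \<xi>: "\<xi> \<in> nonzero_characters (pure_braid_group n)"
  obtains \<xi>' where "\<xi>' \<in> nonzero_characters (pure_braid_group n)"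
    "full_subgraph_connected (cayley_edges (pure_braid_group n) X)
       {g \<in> carrier (pure_braid_group n). \<xi>' g \<ge> 0} \<longleftrightarrow>
     full_subgraph_connected (cayley_edges (pure_braid_group n) X)
       {g \<in> carrier (pure_braid_group n). \<xi> g \<ge> 0}"
    "\<And>k. k \<in> {1..n} \<Longrightarrow> \<xi>' (b_braid n (\<tau> k)) = \<xi> (b_braid n k)"
proof -
  let ?G = "pure_braid_group n" and ?S = "configuration_space n" and ?x = "base_config n"
  let ?f = "\<lambda>y::nat \<Rightarrow> klein. y \<circ> \<tau>" and ?g = "\<lambda>y::nat \<Rightarrow> klein. y \<circ> Hilbert_Choice.inv \<tau>"
  interpret group ?G by (rule group_pure_braid_group)
  have f: "continuous_on ?S ?f" "?f ` ?S \<subseteq> ?S"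
    using configuration_space_permute[OF \<tau>] by (auto intro: continuous_on_permute)
  have g: "continuous_on ?S ?g" "?g ` ?S \<subseteq> ?S"
    using configuration_space_permute[OF permutes_inv[OF \<tau>]] by (auto intro: continuous_on_permute)
  have fg: "?f \<circ> ?g = id" "?g \<circ> ?f = id"
    using permutes_inv_o[OF \<tau>] by (auto simp: fun_eq_iff o_assoc[symmetric])
  have one: "1 \<in> {1..n}" using n by simp
  obtain C C' where C: "C \<in> path_classes ?S ?x (?x \<circ> \<tau>)" "C' \<in> path_classes ?S (?x \<circ> \<tau>) ?x"
    "class_join ?S C' C = homotopy_class ?S (\<lambda>t. ?x \<circ> \<tau>)"
    "class_join ?S C C' = homotopy_class ?S (\<lambda>t. ?x)"
    using b_braid_transport[OF \<tau> one] by metis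
  define \<phi> where "\<phi> = transport ?S ?f C C'"
  have \<phi>: "\<phi> \<in> iso ?G ?G"
    unfolding \<phi>_def pure_braid_group_def using C by (intro transport_iso[OF f g fg])
  define \<xi>' where "\<xi>' = restrict (\<xi> \<circ> \<phi>) (carrier ?G)"
  have "\<xi>' (b_braid n (\<tau> k)) = \<xi> (b_braid n k)" if k: "k \<in> {1..n}" for k
  proof -
    have c: "b_braid n (\<tau> k) \<in> carrier ?G"
      using k permutes_in_image[OF \<tau>] by (intro b_braid_carrier) blast
    obtain D D' where D: "D \<in> path_classes ?S ?x (?x \<circ> \<tau>)" "D' \<in> path_classes ?S (?x \<circ> \<tau>) ?x"
      "class_join ?S D' D = homotopy_class ?S (\<lambda>t. ?x \<circ> \<tau>)"
      "transport ?S ?f D D' (b_braid n (\<tau> k)) = b_braid n k"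
      using b_braid_transport[OF \<tau> k] by metis
    have "\<xi> (transport ?S ?f C C' (b_braid n (\<tau> k))) = \<xi> (transport ?S ?f D D' (b_braid n (\<tau> k)))"
      using \<xi> c unfolding nonzero_characters_def pure_braid_group_def fundamental_group_simps
      by (intro character_transport[OF f C(1-3) D(1-3)]) auto
    then show ?thesis using c by (simp add: \<xi>'_def \<phi>_def D(4))
  qed
  with connected_automorphism_iff[OF \<xi> \<phi> X, folded \<xi>'_def] show thesis
    using that by blast
qed


section \<open>Coordinates\<close>

lemma normalization_permute:
  assumes "\<tau> permutes {1..n}"
  shows "permute_coordinates n \<tau> (normalization n x) = normalization n (x \<circ> \<tau>)"
proof -
  have "(\<Sum>j=1..n. (x j)\<^sup>2) = (\<Sum>j=1..n. (x (\<tau> j))\<^sup>2)"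
    using sum.permute[OF assms, of "\<lambda>j. (x j)\<^sup>2"] by (simp add: comp_def)
  then show ?thesis
    using permutes_in_image[OF assms]
    by (auto simp: permute_coordinates_def normalization_def fun_eq_iff)
qed

text \<open>As \<open>r\<close> is positive, the norm is multiplied by \<open>r\<close> itself. The
  case \<open>r = 1\<close> serves to exchange functions that agree on
  \<open>{1..n}\<close>.\<close>

lemma normalization_scale:
  assumes "r > 0" "\<And>i. i \<in> {1..n} \<Longrightarrow> y i = r * x i"
  shows "normalization n y = normalization n x"
proof -
  have "(\<Sum>j=1..n. (y j)\<^sup>2) = r\<^sup>2 * (\<Sum>j=1..n. (x j)\<^sup>2)"
    using assms(2) by (simp add: sum_distrib_left power_mult_distrib)
  then have "sqrt (\<Sum>j=1..n. (y j)\<^sup>2) = r * sqrt (\<Sum>j=1..n. (x j)\<^sup>2)"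
    using assms(1) by (simp add: real_sqrt_mult)
  then show ?thesis
    using assms by (auto simp: normalization_def fun_eq_iff)
qed

lemma character_class_self: "\<xi> \<in> nonzero_characters G \<Longrightarrow> \<xi> \<in> character_class G \<xi>"
  unfolding character_class_def by (auto intro!: exI[of _ 1])

text \<open>Members of a class differ by positive factors, so the image under
  \<open>normalization\<close> is a singleton and \<open>the_elem\<close> is well defined.\<close>

lemma sphere_coordinates_character_class:
  assumes "\<xi> \<in> nonzero_characters (pure_braid_group n)"
  shows "sphere_coordinates n (character_class (pure_braid_group n) \<xi>) =
    normalization n (\<lambda>i. \<xi> (b_braid n i))"
proof -
  have "normalization n (\<lambda>i. \<xi>' (b_braid n i)) = normalization n (\<lambda>i. \<xi> (b_braid n i))"
    if "\<xi>' \<in> character_class (pure_braid_group n) \<xi>" for \<xi>'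
  proof -
    from that obtain r where "r > 0" "\<forall>g\<in>carrier (pure_braid_group n). \<xi>' g = r * \<xi> g"
      unfolding character_class_def by blast
    then show ?thesis by (intro normalization_scale[of r])
        (simp_all add: b_braid_carrier del: atLeastAtMost_iff)
  qed
  with character_class_self[OF assms]
  have "(\<lambda>\<xi>. normalization n (\<lambda>i. \<xi> (b_braid n i))) ` character_class (pure_braid_group n) \<xi> =
    {normalization n (\<lambda>i. \<xi> (b_braid n i))}" by blast
  then show ?thesis by (simp add: sphere_coordinates_def)
qed

text \<open>Positive multiples of a character have the same half space, so connectedness depends
  only on the class and the complement is described by negating the condition.\<close>

lemma Sigma1_compl_eq:
  "Sigma1_compl G X = {character_class G \<xi> | \<xi>. \<xi> \<in> nonzero_characters G \<and>
     \<not> full_subgraph_connected (cayley_edges G X) {g \<in> carrier G. \<xi> g \<ge> 0}}"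
proof -
  define conn where "conn \<xi> \<longleftrightarrow> full_subgraph_connected (cayley_edges G X)
    {g \<in> carrier G. \<xi> g \<ge> 0}" for \<xi> :: "_ \<Rightarrow> real"
  have "conn \<xi> \<longleftrightarrow> conn \<xi>'"
    if "\<xi>' \<in> nonzero_characters G" "character_class G \<xi> = character_class G \<xi>'" for \<xi> \<xi>'
  proof -
    have "\<xi>' \<in> character_class G \<xi>" using character_class_self[OF that(1)] that(2) by simp
    then obtain r where "r > 0" "\<forall>g\<in>carrier G. \<xi>' g = r * \<xi> g"
      unfolding character_class_def by blast
    then have "{g \<in> carrier G. \<xi> g \<ge> 0} = {g \<in> carrier G. \<xi>' g \<ge> 0}"
      by (auto simp: zero_le_mult_iff)
    then show ?thesis by (simp add: conn_def)
  qed
  then show ?thesis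
    unfolding Sigma1_compl_def Sigma1_def character_sphere_def conn_def[symmetric] by blast
qed

theorem corollary4p3:
  fixes n :: nat
    and X :: "(real \<Rightarrow> nat \<Rightarrow> klein) set set"
    and \<tau> :: "nat \<Rightarrow> nat"
  assumes "n \<ge> 1"
    and "finite X"
    and "X \<subseteq> carrier (pure_braid_group n)"
    and "generate (pure_braid_group n) X = carrier (pure_braid_group n)"
    and "\<tau> permutes {1..n}"
  shows "permute_coordinates n \<tau> ` (sphere_coordinates n ` Sigma1 (pure_braid_group n) X)
           = sphere_coordinates n ` Sigma1 (pure_braid_group n) X \<and>
         permute_coordinates n \<tau> ` (sphere_coordinates n ` Sigma1_compl (pure_braid_group n) X)
           = sphere_coordinates n ` Sigma1_compl (pure_braid_group n) X"
proof -
  let ?G = "pure_braid_group n"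
  define conn where "conn \<xi> \<longleftrightarrow> full_subgraph_connected (cayley_edges ?G X)
    {g \<in> carrier ?G. \<xi> g \<ge> 0}" for \<xi> :: "_ \<Rightarrow> real"
  define \<nu> where "\<nu> \<xi> = normalization n (\<lambda>i. \<xi> (b_braid n i))" for \<xi> :: "_ \<Rightarrow> real"
  have \<tau>': "Hilbert_Choice.inv \<tau> permutes {1..n}" using permutes_inv[OF assms(5)] .
  \<comment> \<open>The Boolean \<open>b\<close> treats the invariant and its complement at once,
    since the new character keeps the truth value of \<open>conn\<close>.\<close>
  have invariant: "permute_coordinates n \<tau> ` \<nu> ` {\<xi> \<in> nonzero_characters ?G. conn \<xi> = b} =
      \<nu> ` {\<xi> \<in> nonzero_characters ?G. conn \<xi> = b}" (is "_ ` \<nu> ` ?A = _") for b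
  proof (intro equalityI subsetI)
    fix y assume "y \<in> permute_coordinates n \<tau> ` \<nu> ` ?A"
    then obtain \<xi> where \<xi>: "\<xi> \<in> ?A" "y = permute_coordinates n \<tau> (\<nu> \<xi>)" by blast
    from \<xi>(1) have \<xi>c: "\<xi> \<in> nonzero_characters ?G" by simp
    \<comment> \<open>The inverse permutation is used here because \<open>\<xi>'\<close> has to take
      the value \<open>\<xi> (b_braid n (\<tau> k))\<close> at \<open>b_braid n k\<close>; the other
      inclusion needs \<open>\<tau>\<close> itself.\<close>
    obtain \<xi>' where \<xi>': "\<xi>' \<in> nonzero_characters ?G" "conn \<xi>' = conn \<xi>"
      "\<And>k. k \<in> {1..n} \<Longrightarrow> \<xi>' (b_braid n (Hilbert_Choice.inv \<tau> k)) = \<xi> (b_braid n k)"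
      by (rule permuted_character[OF assms(1) \<tau>' assms(2-4) \<xi>c, folded conn_def])
        (rule that)
    have "\<xi>' (b_braid n k) = \<xi> (b_braid n (\<tau> k))" if "k \<in> {1..n}" for k
      using \<xi>'(3)[of "\<tau> k"] that permutes_in_image[OF assms(5)] permutes_inverses(2)[OF assms(5)]
      by simp
    then have "y = \<nu> \<xi>'"
      unfolding \<xi>(2) \<nu>_def normalization_permute[OF assms(5)]
      by (intro normalization_scale[of 1]) auto
    moreover have "\<xi>' \<in> ?A" using \<xi>(1) \<xi>'(1,2) by simp
    ultimately show "y \<in> \<nu> ` ?A" by blast
  next
    fix y assume "y \<in> \<nu> ` ?A"
    then obtain \<xi> where \<xi>: "\<xi> \<in> ?A" "y = \<nu> \<xi>" by blast
    from \<xi>(1) have \<xi>c: "\<xi> \<in> nonzero_characters ?G" by simp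
    obtain \<xi>' where \<xi>': "\<xi>' \<in> nonzero_characters ?G" "conn \<xi>' = conn \<xi>"
      "\<And>k. k \<in> {1..n} \<Longrightarrow> \<xi>' (b_braid n (\<tau> k)) = \<xi> (b_braid n k)"
      by (rule permuted_character[OF assms(1,5,2-4) \<xi>c, folded conn_def])
        (rule that)
    then have "y = permute_coordinates n \<tau> (\<nu> \<xi>')"
      unfolding \<xi>(2) \<nu>_def normalization_permute[OF assms(5)]
      by (intro normalization_scale[of 1]) auto
    moreover have "\<xi>' \<in> ?A" using \<xi>(1) \<xi>'(1,2) by simp
    ultimately show "y \<in> permute_coordinates n \<tau> ` \<nu> ` ?A" by blast
  qed
  have "sphere_coordinates n ` Sigma1 ?G X = \<nu> ` {\<xi> \<in> nonzero_characters ?G. conn \<xi> = True}"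
    "sphere_coordinates n ` Sigma1_compl ?G X = \<nu> ` {\<xi> \<in> nonzero_characters ?G. conn \<xi> = False}"
    unfolding Sigma1_def Sigma1_compl_eq \<nu>_def conn_def
    by (force simp: sphere_coordinates_character_class)+
  then show ?thesis using invariant[of True] invariant[of False] by simp
qed

end
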